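(* Let $T_1,T_2$ be trees with $n$ vertices such that $T_2$ covers $T_1$ in $\mathsf{GTS}_n$. Then for all $q\in\mathbb{R}\setminus\{0\}$ with $|q|\le1$, $\lambda_{\min}(\mathcal{L}_{T_1}^q)\ge\lambda_{\min}(\mathcal{L}_{T_2}^q)$.
   Context: For a tree $T$ with degree diagonal matrix $D$ and adjacency matrix $A$, $\mathcal{L}_T^q=I+q^2(D-I)-qA$; $\lambda_{\min}$ is its smallest eigenvalue. Generalized tree shift: for a tree $T$ and distinct vertices $u,w$ such that each internal vertex of the $u$–$w$ path $P$ has degree 2, with $w'$ the neighbour of $w$ on $P$, replace each edge $\{w,z\}$, $z\ne w'$, by $\{u,z\}$. $\mathsf{GTS}_n$: partial order on isomorphism classes of $n$-vertex trees, $T_1\le T_2$ iff $T_2$ arises from $T_1$ by finitely many generalized tree shifts; $T_2$ covers $T_1$ if $T_1\le T_2$, $T_1\ne T_2$, and no tree lies strictly between them. *)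

theory Defs
  imports
    Complex_Main
    "Graph_Theory.Graph_Theory"
    "Jordan_Normal_Form.Char_Poly"
begin

text \<open>
  An undirected simple graph is a \<open>pair_graph\<close>: every undirected edge is represented by its two
  orientations, so the degree of a vertex is its out-degree.

  The library's \<open>Digraph_Component.tree\<close> is not used, because its \<open>forest\<close> condition also forbids
  the directed cycles of length 2 that arise from the two orientations of a single edge.  Cycles of
  an undirected graph are the library cycles of length at least 3.
\<close>

definition is_tree :: "'a pair_pre_digraph \<Rightarrow> bool" where
  "is_tree T \<longleftrightarrow> pair_graph T \<and> Digraph_Component.connected (with_proj T) \<and>
     \<not> (\<exists>p. pre_digraph.cycle (with_proj T) p \<and> 3 \<le> length p)"

abbreviation deg :: "'a pair_pre_digraph \<Rightarrow> 'a \<Rightarrow> nat" where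
  "deg T v \<equiv> out_degree (with_proj T) v"

definition n_trees :: "nat \<Rightarrow> nat pair_pre_digraph set" where
  "n_trees n = {T. is_tree T \<and> pverts T = {0..<n}}"

definition deg_matrix :: "nat \<Rightarrow> nat pair_pre_digraph \<Rightarrow> real mat" where
  "deg_matrix n T = mat n n (\<lambda>(i, j). if i = j then real (deg T i) else 0)"

definition adj_matrix :: "nat \<Rightarrow> nat pair_pre_digraph \<Rightarrow> real mat" where
  "adj_matrix n T = mat n n (\<lambda>(i, j). if (i, j) \<in> parcs T then 1 else 0)"

definition q_laplacian :: "nat \<Rightarrow> real \<Rightarrow> nat pair_pre_digraph \<Rightarrow> real mat" where
  "q_laplacian n q T =
     1\<^sub>m n + q\<^sup>2 \<cdot>\<^sub>m (deg_matrix n T - 1\<^sub>m n) - q \<cdot>\<^sub>m adj_matrix n T"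

text \<open>
  Only used for real symmetric matrices of positive dimension; for these the set of real
  eigenvalues is the whole spectrum, finite and nonempty.
\<close>

definition lambda_min :: "real mat \<Rightarrow> real" where
  "lambda_min M = Min {k. eigenvalue M k}"

definition tree_shift :: "'a pair_pre_digraph \<Rightarrow> 'a \<Rightarrow> 'a \<Rightarrow> 'a \<Rightarrow> 'a pair_pre_digraph" where
  "tree_shift T u w w' =
     (let Z = {z. (w, z) \<in> parcs T \<and> z \<noteq> w'} in
      T \<lparr> parcs := (parcs T - ({w} \<times> Z \<union> Z \<times> {w})) \<union> ({u} \<times> Z \<union> Z \<times> {u}) \<rparr>)"

text \<open>
  \<open>p\<close> is the vertex list of the path from \<open>u\<close> to \<open>w\<close>, so \<open>last (butlast p)\<close> is the neighbour of \<open>w\<close>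
  on it.
\<close>

definition gts_step :: "'a pair_pre_digraph \<Rightarrow> 'a pair_pre_digraph \<Rightarrow> bool" where
  "gts_step T T' \<longleftrightarrow>
     (\<exists>u w p. u \<noteq> w \<and> vpath p (with_proj T) \<and> hd p = u \<and> last p = w \<and>
        (\<forall>v \<in> set p - {u, w}. deg T v = 2) \<and>
        T' = tree_shift T u w (last (butlast p)))"

definition iso_rel :: "nat \<Rightarrow> nat pair_pre_digraph rel" where
  "iso_rel n = {(T, T'). T \<in> n_trees n \<and> T' \<in> n_trees n \<and>
     digraph_iso (with_proj T) (with_proj T')}"

definition iso_class :: "nat \<Rightarrow> nat pair_pre_digraph \<Rightarrow> nat pair_pre_digraph set" where
  "iso_class n T = iso_rel n `` {T}"

definition GTS_carrier :: "nat \<Rightarrow> nat pair_pre_digraph set set" where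
  "GTS_carrier n = n_trees n // iso_rel n"

definition GTS_step :: "nat \<Rightarrow> nat pair_pre_digraph set \<Rightarrow> nat pair_pre_digraph set \<Rightarrow> bool" where
  "GTS_step n X Y \<longleftrightarrow> X \<in> GTS_carrier n \<and> Y \<in> GTS_carrier n \<and>
     (\<exists>T \<in> X. \<exists>T' \<in> Y. gts_step T T')"

definition GTS_le :: "nat \<Rightarrow> nat pair_pre_digraph set \<Rightarrow> nat pair_pre_digraph set \<Rightarrow> bool" where
  "GTS_le n X Y \<longleftrightarrow> X \<in> GTS_carrier n \<and> Y \<in> GTS_carrier n \<and> (GTS_step n)\<^sup>*\<^sup>* X Y"

text \<open>\<open>GTS_covers n Y X\<close>: \<open>Y\<close> covers \<open>X\<close>.\<close>

definition GTS_covers :: "nat \<Rightarrow> nat pair_pre_digraph set \<Rightarrow> nat pair_pre_digraph set \<Rightarrow> bool" where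
  "GTS_covers n Y X \<longleftrightarrow> GTS_le n X Y \<and> X \<noteq> Y \<and>
     \<not> (\<exists>Z \<in> GTS_carrier n. GTS_le n X Z \<and> GTS_le n Z Y \<and> Z \<noteq> X \<and> Z \<noteq> Y)"

end

theory Submission
  imports Defs
begin

text \<open>
  If a tree is rooted at \<open>r\<close>, then \<open>x\<^sup>T L x = (1 - q\<^sup>2) x\<^sub>r\<^sup>2 + (\<Sum>v \<noteq> r. (x\<^sub>v - q x\<^bsub>par v\<^esub>)\<^sup>2)\<close>; in particular
  the form is nonnegative for \<open>\<bar>q\<bar> \<le> 1\<close>.  Take a minimizing eigenvector \<open>x\<close> of the first tree; a tree is
  bipartite, so one may assume \<open>q > 0\<close>, and then \<open>x \<ge> 0\<close>.  Up to isomorphism, a shift along a path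
  from \<open>u\<close> to \<open>w\<close> does not depend on the direction of the path, so one may assume
  \<open>x\<^sub>w \<le> x\<^sub>u\<close>.  Root both trees at \<open>u\<close>.  The vector \<open>y\<close> on the shifted tree with \<open>y\<^sub>u = x\<^sub>u\<close> and the
  same differences as \<open>x\<close> has the same form value, and \<open>y \<ge> x\<close>.  Hence its Rayleigh quotient is at
  most the smallest eigenvalue of the first tree.
\<close>

section \<open>The smallest eigenvalue as minimal Rayleigh quotient\<close>

lemma scalar_prod_self_eq_sum:
  "(x :: real vec) \<in> carrier_vec n \<Longrightarrow> x \<bullet> x = (\<Sum>i<n. (x $ i)\<^sup>2)"
  by (auto simp: scalar_prod_def power2_eq_square atLeast0LessThan)

lemma scalar_prod_self_nonneg: "0 \<le> (x :: real vec) \<bullet> x"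
  by (auto simp: scalar_prod_def intro: sum_nonneg)

lemma scalar_prod_self_pos:
  assumes "(x :: real vec) \<in> carrier_vec n" "x \<noteq> 0\<^sub>v n"
  shows "0 < x \<bullet> x"
  using conjugate_square_greater_0_vec[OF assms(1)] assms by (auto simp: conjugate_vec_def scalar_prod_def)

lemma scalar_prod_mat_eq_sum:
  assumes "(M :: real mat) \<in> carrier_mat n n" "x \<in> carrier_vec n"
  shows "x \<bullet> (M *\<^sub>v x) = (\<Sum>i<n. \<Sum>j<n. x $ i * M $$ (i,j) * x $ j)"
  using assms by (auto simp: scalar_prod_def atLeast0LessThan sum_distrib_left mult.assoc intro!: sum.cong)

text \<open>Each \<open>\<bar>x $ i\<bar> * \<bar>x $ j\<bar>\<close> is at most
  \<open>x \<bullet> x\<close>, because twice a product is at most the sum of the squares. The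
  constant is crude; only its finiteness matters.\<close>

lemma quadratic_form_bound:
  assumes M: "(M :: real mat) \<in> carrier_mat n n" and x: "x \<in> carrier_vec n"
  shows "\<bar>x \<bullet> (M *\<^sub>v x)\<bar> \<le> (\<Sum>i<n. \<Sum>j<n. \<bar>M $$ (i,j)\<bar>) * (x \<bullet> x)"
proof -
  have sq: "(x $ i)\<^sup>2 \<le> x \<bullet> x" if "i < n" for i
    unfolding scalar_prod_self_eq_sum[OF x] using that by (intro member_le_sum) auto
  have prod: "\<bar>x $ i * M $$ (i,j) * x $ j\<bar> \<le> \<bar>M $$ (i,j)\<bar> * (x \<bullet> x)" if "i < n" "j < n" for i j
  proof -
    have "0 \<le> (\<bar>x $ i\<bar> - \<bar>x $ j\<bar>)\<^sup>2" by simp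
    then have "2 * (\<bar>x $ i\<bar> * \<bar>x $ j\<bar>) \<le> (x $ i)\<^sup>2 + (x $ j)\<^sup>2"
      by (simp add: power2_diff)
    then have "\<bar>x $ i\<bar> * \<bar>x $ j\<bar> \<le> x \<bullet> x" using sq[OF that(1)] sq[OF that(2)] by linarith
    then have "\<bar>M $$ (i,j)\<bar> * (\<bar>x $ i\<bar> * \<bar>x $ j\<bar>) \<le> \<bar>M $$ (i,j)\<bar> * (x \<bullet> x)"
      by (rule mult_left_mono) simp
    then show ?thesis by (simp add: abs_mult mult_ac)
  qed
  have "\<bar>x \<bullet> (M *\<^sub>v x)\<bar> \<le> (\<Sum>i<n. \<Sum>j<n. \<bar>x $ i * M $$ (i,j) * x $ j\<bar>)"
    unfolding scalar_prod_mat_eq_sum[OF M x] by (intro order_trans[OF sum_abs] sum_mono sum_abs)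
  also have "\<dots> \<le> (\<Sum>i<n. \<Sum>j<n. \<bar>M $$ (i,j)\<bar> * (x \<bullet> x))"
    using prod by (intro sum_mono) auto
  finally show ?thesis by (simp add: sum_distrib_right)
qed

lemma symmetric_mat_scalar_prod:
  assumes "(M :: real mat) \<in> carrier_mat n n" "transpose_mat M = M" "x \<in> carrier_vec n" "y \<in> carrier_vec n"
  shows "x \<bullet> (M *\<^sub>v y) = (M *\<^sub>v x) \<bullet> y"
  using transpose_vec_mult_scalar[OF assms(1,4,3)] assms(2) by simp

text \<open>With \<open>M z = x\<close>, expand \<open>0 \<le> (x - t z) \<bullet> M (x - t z)\<close> and use that \<open>x \<bullet> z\<close> is at most a
  multiple of \<open>x \<bullet> x\<close>, because \<open>z\<close> is the image of \<open>x\<close> under the inverse matrix.\<close>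

lemma positive_definite_if_semidefinite_nonsingular:
  assumes M: "(M :: real mat) \<in> carrier_mat n n" and sym: "transpose_mat M = M"
    and psd: "\<And>x. x \<in> carrier_vec n \<Longrightarrow> 0 \<le> x \<bullet> (M *\<^sub>v x)"
    and det: "det M \<noteq> 0"
  shows "\<exists>c>0. \<forall>x \<in> carrier_vec n. c * (x \<bullet> x) \<le> x \<bullet> (M *\<^sub>v x)"
proof -
  from det_non_zero_imp_unit[OF M det, of "()"]
  obtain B where B: "B \<in> carrier_mat n n" and MB: "M * B = 1\<^sub>m n"
    unfolding Units_def ring_mat_def by auto
  \<comment> \<open>The summand 1 makes \<open>C\<close> positive even when the sum
    vanishes.\<close>
  define C where "C = 1 + (\<Sum>i<n. \<Sum>j<n. \<bar>B $$ (i,j)\<bar>)"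
  have C: "C > 0" unfolding C_def by (smt (verit) sum_nonneg abs_ge_zero)
  have "1 / C * (x \<bullet> x) \<le> x \<bullet> (M *\<^sub>v x)" if x: "x \<in> carrier_vec n" for x
  proof -
    define z where "z = B *\<^sub>v x"
    have z: "z \<in> carrier_vec n" unfolding z_def using B x by simp
    have Mz: "M *\<^sub>v z = x" unfolding z_def using assoc_mult_mat_vec[OF M B x] MB x by simp
    have Mx: "M *\<^sub>v x \<in> carrier_vec n" using M x by simp
    have zMx: "z \<bullet> (M *\<^sub>v x) = x \<bullet> x"
      using symmetric_mat_scalar_prod[OF M sym z x] Mz by simp
    have "x \<bullet> z \<le> C * (x \<bullet> x)"
      using quadratic_form_bound[OF B x] scalar_prod_self_nonneg[of x] unfolding C_def z_def
      by (auto simp: algebra_simps)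
    \<comment> \<open>This \<open>t\<close> minimizes \<open>2 * t + C * t * t\<close>, the
      coefficient of \<open>x \<bullet> x\<close> in the bound below; the minimum is
      \<open>- 1 / C\<close>.\<close>
    define t where "t = - 1 / C"
    have eq: "M *\<^sub>v (x + t \<cdot>\<^sub>v z) = M *\<^sub>v x + t \<cdot>\<^sub>v x"
      using M x z by (simp add: mult_add_distrib_mat_vec mult_mat_vec Mz)
    have "0 \<le> (x + t \<cdot>\<^sub>v z) \<bullet> (M *\<^sub>v (x + t \<cdot>\<^sub>v z))"
      by (rule psd) (use x z in simp)
    also have "\<dots> = x \<bullet> (M *\<^sub>v x) + 2 * t * (x \<bullet> x) + t * t * (x \<bullet> z)"
      unfolding eq using x z Mx zMx comm_scalar_prod[OF x z]
      by (simp add: add_scalar_prod_distrib[of _ n] scalar_prod_add_distrib[of _ n] algebra_simps)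
    also have "\<dots> \<le> x \<bullet> (M *\<^sub>v x) + 2 * t * (x \<bullet> x) + t * t * (C * (x \<bullet> x))"
      using \<open>x \<bullet> z \<le> C * (x \<bullet> x)\<close> by (intro add_left_mono mult_left_mono) auto
    also have "\<dots> = x \<bullet> (M *\<^sub>v x) - 1 / C * (x \<bullet> x)"
      using C by (simp add: t_def field_simps)
    finally show ?thesis by simp
  qed
  then show ?thesis using C by (intro exI[of _ "1 / C"]) auto
qed

text \<open>Let \<open>m\<close> be the supremum of the lower bounds of the Rayleigh quotient. If
  \<open>M - m I\<close> were nonsingular, it would be positive definite with a margin
  \<open>c\<close>, and \<open>m + c\<close> would still be a lower bound. So \<open>m\<close> is an
  eigenvalue, and no eigenvalue lies below it.\<close>

lemma lambda_min_Rayleigh: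
  assumes M: "(M :: real mat) \<in> carrier_mat n n" and sym: "transpose_mat M = M" and n: "0 < n"
  shows "eigenvalue M (lambda_min M)"
    and "x \<in> carrier_vec n \<Longrightarrow> lambda_min M * (x \<bullet> x) \<le> x \<bullet> (M *\<^sub>v x)"
proof -
  define S where "S = {m. \<forall>x \<in> carrier_vec n. m * (x \<bullet> x) \<le> x \<bullet> (M *\<^sub>v x)}"
  define K where "K = (\<Sum>i<n. \<Sum>j<n. \<bar>M $$ (i,j)\<bar>)"
  have ne: "- K \<in> S"
    unfolding S_def using quadratic_form_bound[OF M] by (force simp: K_def abs_le_iff)
  \<comment> \<open>The value at one unit vector bounds \<open>S\<close> from above.\<close>
  define e where "e = unit_vec n 0 \<bullet> (M *\<^sub>v (unit_vec n 0 :: real vec))"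
  have "m \<le> e" if "m \<in> S" for m
  proof -
    have "m * (unit_vec n 0 \<bullet> (unit_vec n 0 :: real vec)) \<le> e"
      using that unfolding S_def e_def by (auto simp del: scalar_prod_right_unit scalar_prod_left_unit)
    then show ?thesis using n by simp
  qed
  then have bdd: "bdd_above S" by (rule bdd_aboveI)
  define m where "m = Sup S"
  have mS: "m * (x \<bullet> x) \<le> x \<bullet> (M *\<^sub>v x)" if x: "x \<in> carrier_vec n" for x
  proof (cases "x \<bullet> x = 0")
    case True
    \<comment> \<open>The multiple of \<open>x \<bullet> x\<close> vanishes, so any element of
      \<open>S\<close> proves the bound.\<close>
    then show ?thesis using ne x unfolding S_def by force
  next
    case False
    then have pos: "0 < x \<bullet> x" using scalar_prod_self_nonneg[of x] by linarith
    have "m \<le> x \<bullet> (M *\<^sub>v x) / (x \<bullet> x)" unfolding m_def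
      proof (rule cSup_least)
      show "S \<noteq> {}" using ne by blast
      show "a \<le> x \<bullet> (M *\<^sub>v x) / (x \<bullet> x)" if "a \<in> S" for a
        using that x pos by (simp add: S_def field_simps)
    qed
    then show ?thesis using pos by (simp add: field_simps)
  qed
  define N where "N = char_matrix M m"
  have N: "N \<in> carrier_mat n n" unfolding N_def using M by simp
  have Nx: "N *\<^sub>v x = M *\<^sub>v x + (- m) \<cdot>\<^sub>v x" if x: "x \<in> carrier_vec n" for x
    unfolding N_def char_matrix_def using M x
    by (subst add_mult_distrib_mat_vec[of _ n n]) auto
  have form: "x \<bullet> (N *\<^sub>v x) = x \<bullet> (M *\<^sub>v x) - m * (x \<bullet> x)" if x: "x \<in> carrier_vec n" for x
    unfolding Nx[OF x] using x M by (subst scalar_prod_add_distrib[of _ n]) auto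
  have symN: "transpose_mat N = N"
    unfolding N_def char_matrix_def using M sym
    by (intro eq_matI) (auto simp: transpose_mat_def mat_eq_iff)
  have ev: "eigenvalue M m"
  proof (rule ccontr)
    assume "\<not> eigenvalue M m"
    then have "det N \<noteq> 0" using eigenvalue_det[OF M] N_def by simp
    with positive_definite_if_semidefinite_nonsingular[OF N symN] form mS
    obtain c where c: "c > 0" "\<forall>x \<in> carrier_vec n. c * (x \<bullet> x) \<le> x \<bullet> (N *\<^sub>v x)" by auto
    then have "m + c \<in> S" unfolding S_def using form by (auto simp: algebra_simps)
    then have "m + c \<le> m" unfolding m_def using bdd by (rule cSup_upper)
    then show False using c by simp
  qed
  have "m \<le> k" if k: "eigenvalue M k" for k
  proof -
    from k obtain v where v: "v \<in> carrier_vec n" "v \<noteq> 0\<^sub>v n" "M *\<^sub>v v = k \<cdot>\<^sub>v v"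
      unfolding eigenvalue_def eigenvector_def using M by auto
    then have "m * (v \<bullet> v) \<le> k * (v \<bullet> v)" using mS[OF v(1)] by simp
    then show ?thesis using scalar_prod_self_pos[OF v(1,2)] by simp
  qed
  moreover have "finite {k. eigenvalue M k}"
  proof -
    have "char_poly M \<noteq> 0" using degree_monic_char_poly[OF M] by auto
    then show ?thesis unfolding eigenvalue_root_char_poly[OF M] by (rule poly_roots_finite)
  qed
  ultimately have eq: "lambda_min M = m"
    unfolding lambda_min_def using ev by (intro Min_eqI) auto
  show "eigenvalue M (lambda_min M)" using ev eq by simp
  show "lambda_min M * (x \<bullet> x) \<le> x \<bullet> (M *\<^sub>v x)" if "x \<in> carrier_vec n"
    using mS[OF that] eq by simp
qed

section \<open>The quadratic form of a rooted tree\<close>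

text \<open>For the symmetric arc set of a graph this is \<open>x\<^sup>T L x\<close>: summing
  \<open>q\<^sup>2 * (x a)\<^sup>2\<close> over the arcs that leave \<open>a\<close> produces the
  degree term. No matrix enters, so the vertices may have any type.\<close>

definition tree_form :: "'a set \<Rightarrow> 'a rel \<Rightarrow> real \<Rightarrow> ('a \<Rightarrow> real) \<Rightarrow> real" where
  "tree_form V E q x =
     (\<Sum>v\<in>V. (1 - q\<^sup>2) * (x v)\<^sup>2) + (\<Sum>(a, b)\<in>E. q\<^sup>2 * (x a)\<^sup>2 - q * x a * x b)"

text \<open>\<open>h\<close> need not be the depth: any function decreasing towards the root
  supports induction and recursion, so the same \<open>h\<close> survives a shift.\<close>

definition rooted_tree :: "'a set \<Rightarrow> 'a rel \<Rightarrow> 'a \<Rightarrow> ('a \<Rightarrow> 'a) \<Rightarrow> ('a \<Rightarrow> nat) \<Rightarrow> bool" where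
  "rooted_tree V E r par h \<longleftrightarrow> finite V \<and> r \<in> V \<and>
     (\<forall>v\<in>V - {r}. par v \<in> V \<and> h (par v) < h v) \<and>
     E = (\<lambda>v. (v, par v)) ` (V - {r}) \<union> (\<lambda>v. (par v, v)) ` (V - {r})"

text \<open>Completing squares: a vertex other than the root combines its own term with both
  orientations of the edge to its parent into one square. Only the term of the root is left
  over.\<close>

lemma tree_form_rooted:
  assumes "rooted_tree V E r par h"
  shows "tree_form V E q x = (1 - q\<^sup>2) * (x r)\<^sup>2 + (\<Sum>v\<in>V - {r}. (x v - q * x (par v))\<^sup>2)"
proof -
  let ?W = "V - {r}"
  let ?f = "\<lambda>(a, b). q\<^sup>2 * (x a)\<^sup>2 - q * x a * x b"
  have V: "finite V" "r \<in> V" and h: "\<And>v. v \<in> ?W \<Longrightarrow> h (par v) < h v"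
    and E: "E = (\<lambda>v. (v, par v)) ` ?W \<union> (\<lambda>v. (par v, v)) ` ?W"
    using assms by (auto simp: rooted_tree_def)
  \<comment> \<open>An arc in both images would join two vertices that are each other's parent,
    against the decrease of \<open>h\<close>.\<close>
  have disj: "(\<lambda>v. (v, par v)) ` ?W \<inter> (\<lambda>v. (par v, v)) ` ?W = {}"
  proof -
    have "v \<noteq> par v'" if "v \<in> ?W" "v' \<in> ?W" "par v = v'" for v v'
      using h[OF that(1)] h[OF that(2)] that(3) by auto
    then show ?thesis by blast
  qed
  have "sum ?f E = (\<Sum>v\<in>?W. ?f (v, par v)) + (\<Sum>v\<in>?W. ?f (par v, v))"
    unfolding E using V disj
    by (subst sum.union_disjoint) (auto simp: sum.reindex inj_on_def)
  moreover have "(\<Sum>v\<in>V. (1 - q\<^sup>2) * (x v)\<^sup>2) = (1 - q\<^sup>2) * (x r)\<^sup>2 + (\<Sum>v\<in>?W. (1 - q\<^sup>2) * (x v)\<^sup>2)"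
    using V by (simp add: sum.remove)
  moreover have "(\<Sum>v\<in>?W. (1 - q\<^sup>2) * (x v)\<^sup>2) + ((\<Sum>v\<in>?W. ?f (v, par v)) + (\<Sum>v\<in>?W. ?f (par v, v)))
      = (\<Sum>v\<in>?W. (x v - q * x (par v))\<^sup>2)"
    unfolding sum.distrib[symmetric] by (rule sum.cong) (auto simp: power2_eq_square algebra_simps)
  ultimately show ?thesis unfolding tree_form_def by simp
qed

lemma rooted_tree_root_less:
  assumes "rooted_tree V E r par h" "v \<in> V" "v \<noteq> r"
  shows "h r < h v"
  using assms(2,3)
proof (induction "h v" arbitrary: v rule: less_induct)
  case less
  then have "par v \<in> V" "h (par v) < h v" using assms(1) by (auto simp: rooted_tree_def)
  then show ?case using less by (cases "par v = r") (auto intro: less_trans)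
qed

text \<open>Well-founded recursion along \<open>h\<close>. It allows the root value and the
  differences in the rooted form to be prescribed freely.\<close>

lemma rooted_tree_recursion:
  assumes "rooted_tree V E r par h"
  shows "\<exists>y. y r = a \<and> (\<forall>v\<in>V - {r}. y v = f v (y (par v)))"
proof -
  define F where "F = (\<lambda>y v. if v \<in> V - {r} then f v (y (par v)) else a)"
  have "adm_wf (measure h) F"
    using assms by (auto simp: adm_wf_def F_def rooted_tree_def)
  then have "wfrec (measure h) F = F (wfrec (measure h) F)"
    by (intro wfrec_fixpoint) auto
  then show ?thesis
    by (intro exI[of _ "wfrec (measure h) F"])
       (metis (mono_tags, lifting) DiffD2 F_def insertI1)
qed

lemma tree_form_nonneg:
  assumes "rooted_tree V E r par h" "\<bar>q\<bar> \<le> 1"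
  shows "0 \<le> tree_form V E q x"
  using assms(2) unfolding tree_form_rooted[OF assms(1)]
  by (intro add_nonneg_nonneg sum_nonneg mult_nonneg_nonneg) (auto simp: abs_square_le_1)

text \<open>Multiply \<open>x\<close> by a sign \<open>s\<close> that alternates along every edge,
  as in a 2-colouring; then each difference changes at most its sign.\<close>

lemma tree_form_uminus:
  assumes "rooted_tree V E r par h"
  shows "\<exists>y. (\<forall>v\<in>V. (y v)\<^sup>2 = (x v)\<^sup>2) \<and> tree_form V E (- q) y = tree_form V E q x"
proof -
  obtain s :: "'a \<Rightarrow> real" where s: "s r = 1" "\<And>v. v \<in> V - {r} \<Longrightarrow> s v = - s (par v)"
    using rooted_tree_recursion[OF assms, of "1 :: real" "\<lambda>_ t. - t"] by auto
  have par: "\<And>v. v \<in> V - {r} \<Longrightarrow> par v \<in> V \<and> h (par v) < h v" and r: "r \<in> V"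
    using assms by (auto simp: rooted_tree_def)
  have sq: "(s v)\<^sup>2 = 1" if "v \<in> V" for v
    using that
  proof (induction "h v" arbitrary: v rule: less_induct)
    case less
    then show ?case using s par[of v] by (cases "v = r") auto
  qed
  have "(s v * x v - (- q) * (s (par v) * x (par v)))\<^sup>2 = (x v - q * x (par v))\<^sup>2"
    if "v \<in> V - {r}" for v
  proof -
    have "s v * x v - (- q) * (s (par v) * x (par v)) = s v * (x v - q * x (par v))"
      using s(2)[OF that] by (simp add: algebra_simps)
    then show ?thesis using sq that by (simp add: power_mult_distrib)
  qed
  then have "tree_form V E (- q) (\<lambda>v. s v * x v) = tree_form V E q x"
    unfolding tree_form_rooted[OF assms] using s(1) by (simp add: power_mult_distrib)
  then show ?thesis using sq by (intro exI[of _ "\<lambda>v. s v * x v"]) (auto simp: power_mult_distrib)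
qed

lemma tree_form_abs:
  assumes "rooted_tree V E r par h"
  shows "\<exists>y. (\<forall>v\<in>V. (y v)\<^sup>2 = (x v)\<^sup>2) \<and> tree_form V E q y = tree_form V E \<bar>q\<bar> x"
proof (cases "q \<ge> 0")
  case False
  then show ?thesis using tree_form_uminus[OF assms, of x "- q"] by simp
qed auto

text \<open>The squares stay and the cross terms can only drop, so a minimizing vector may be
  replaced by a nonnegative one.\<close>

lemma tree_form_abs_le: "tree_form V E \<bar>q\<bar> (\<lambda>v. \<bar>x v\<bar>) \<le> tree_form V E q x"
proof -
  have "q * x a * x b \<le> \<bar>q\<bar> * \<bar>x a\<bar> * \<bar>x b\<bar>" for a b
    by (metis abs_ge_self abs_mult)
  then show ?thesis unfolding tree_form_def by (auto intro!: sum_mono)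
qed

text \<open>Invariance under relabelling, applied to path reversal and to isomorphisms. Injectivity
  on \<open>E\<close> is a separate hypothesis because \<open>E\<close> is an arbitrary relation,
  not confined to \<open>V\<close>.\<close>

lemma tree_form_image:
  assumes "bij_betw f V V'" "inj_on (map_prod f f) E" "E' = map_prod f f ` E"
  shows "tree_form V' E' q x = tree_form V E q (x \<circ> f)"
  unfolding tree_form_def assms(3) sum.reindex[OF assms(2)] sum.reindex_bij_betw[OF assms(1), symmetric]
  by (simp add: case_prod_beta o_def)

section \<open>Shifts of rooted trees\<close>

lemma parcs_tree_shift:
  "parcs (tree_shift T u w w') =
     (let Z = {z. (w, z) \<in> parcs T \<and> z \<noteq> w'} in
      (parcs T - ({w} \<times> Z \<union> Z \<times> {w})) \<union> ({u} \<times> Z \<union> Z \<times> {u}))"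
  by (simp add: tree_shift_def Let_def)

text \<open>The neighbours of \<open>w\<close> other than its parent are its children, so a shift
  onto the root only changes their parent to \<open>r\<close>. As \<open>h r\<close> is minimal,
  \<open>h\<close> still decreases.\<close>

lemma rooted_tree_shift:
  assumes T: "rooted_tree (pverts T) (parcs T) r par h" and w: "w \<in> pverts T" "w \<noteq> r"
  shows "rooted_tree (pverts T) (parcs (tree_shift T r w (par w))) r
           (\<lambda>v. if par v = w then r else par v) h"
proof -
  let ?W = "pverts T - {r}"
  have V: "finite (pverts T)" "r \<in> pverts T"
    and h: "\<And>v. v \<in> ?W \<Longrightarrow> par v \<in> pverts T \<and> h (par v) < h v"
    and E: "parcs T = (\<lambda>v. (v, par v)) ` ?W \<union> (\<lambda>v. (par v, v)) ` ?W"
    using T by (auto simp: rooted_tree_def)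
  have arc: "(a, b) \<in> parcs T \<longleftrightarrow> a \<in> ?W \<and> b = par a \<or> b \<in> ?W \<and> a = par b" for a b
    unfolding E by auto
  have asym: "par (par v) \<noteq> v" if "v \<in> ?W" "par v \<in> ?W" for v
    using h[OF that(1)] h[OF that(2)] by auto
  have "w \<in> ?W" using w by simp
  define Z where "Z = {z. (w, z) \<in> parcs T \<and> z \<noteq> par w}"
  have Z: "z \<in> Z \<longleftrightarrow> z \<in> ?W \<and> par z = w" for z
    unfolding Z_def mem_Collect_eq arc using \<open>w \<in> ?W\<close> asym by metis
  define E' where "E' = parcs (tree_shift T r w (par w))"
  have arc': "(a, b) \<in> E' \<longleftrightarrow>
      (a, b) \<in> parcs T \<and> \<not> (a = w \<and> b \<in> Z) \<and> \<not> (b = w \<and> a \<in> Z) \<or> a = r \<and> b \<in> Z \<or> b = r \<and> a \<in> Z" for a b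
    unfolding E'_def parcs_tree_shift Z_def[symmetric] Let_def by blast
  let ?par = "\<lambda>v. if par v = w then r else par v"
  have "(a, b) \<in> E' \<longleftrightarrow> a \<in> ?W \<and> b = ?par a \<or> b \<in> ?W \<and> a = ?par b" for a b
    unfolding arc' arc Z using asym[of a] asym[of b]
    by (cases "par a = w"; cases "par b = w") (simp_all, blast+)
  then have "E' = (\<lambda>v. (v, ?par v)) ` ?W \<union> (\<lambda>v. (?par v, v)) ` ?W" by auto
  moreover have "h r < h v" if "v \<in> ?W" for v using rooted_tree_root_less[OF T] that by simp
  ultimately show ?thesis
    unfolding rooted_tree_def E'_def[symmetric] using V h by auto
qed

text \<open>Keeping all differences \<open>y v - q * y (parent v)\<close> preserves the form, and since the moved
  subtree is attached at a vertex of larger value, all values grow.\<close>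

lemma tree_form_shift_le:
  assumes T: "rooted_tree (pverts T) (parcs T) r par h" and w: "w \<in> pverts T" "w \<noteq> r"
    and x: "\<And>v. 0 \<le> x v" "x w \<le> x r" and q: "0 \<le> q"
  shows "\<exists>y. (\<forall>v\<in>pverts T. x v \<le> y v) \<and>
    tree_form (pverts T) (parcs (tree_shift T r w (par w))) q y = tree_form (pverts T) (parcs T) q x"
proof -
  let ?par = "\<lambda>v. if par v = w then r else par v"
  note T' = rooted_tree_shift[OF T w]
  obtain y where y: "y r = x r"
      "\<And>v. v \<in> pverts T - {r} \<Longrightarrow> y v = q * y (?par v) + (x v - q * x (par v))"
    using rooted_tree_recursion[OF T', of "x r" "\<lambda>v t. q * t + (x v - q * x (par v))"] by auto
  have le: "x v \<le> y v" if "v \<in> pverts T" for v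
    using that
  proof (induction "h v" arbitrary: v rule: less_induct)
    case less
    show ?case
    proof (cases "v = r")
      case False
      then have v: "v \<in> pverts T - {r}" using less by auto
      then have "par v \<in> pverts T" "h (par v) < h v" using T by (auto simp: rooted_tree_def)
      \<comment> \<open>If \<open>par v = w\<close>, the new parent is \<open>r\<close> and
        \<open>x w \<le> x r = y r\<close>; otherwise the parent is unchanged and the induction
        hypothesis applies.\<close>
      then have "x (par v) \<le> y (?par v)" using less x(2) y(1) by auto
      then have "q * x (par v) \<le> q * y (?par v)" using q by (rule mult_left_mono)
      then show ?thesis using y(2)[OF v] by linarith
    qed (simp add: y)
  qed
  have "tree_form (pverts T) (parcs (tree_shift T r w (par w))) q y = tree_form (pverts T) (parcs T) q x"
    unfolding tree_form_rooted[OF T'] tree_form_rooted[OF T] using y by simp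
  then show ?thesis using le by blast
qed

section \<open>Rooting a tree at a given vertex\<close>

text \<open>A path is closed up through an outside vertex. For a one-vertex \<open>p\<close> the
  result runs along a single edge and back, so the length has to be checked where the lemma is
  applied.\<close>

lemma cycle_vwalk_arcs:
  assumes "vwalk p (with_proj T)" "distinct p" "(b, hd p) \<in> parcs T" "(last p, b) \<in> parcs T"
    and b: "b \<in> pverts T" "b \<notin> set p"
  shows "pre_digraph.cycle (with_proj T) (vwalk_arcs (b # p @ [b]))"
proof -
  have verts: "pawalk_verts (hd l) (vwalk_arcs l) = l" if "l \<noteq> []" for l :: "'a list"
    using that by (induction l rule: vwalk_arcs.induct) auto
  have cas: "pcas (hd l) (vwalk_arcs l) (last l)" if "l \<noteq> []" for l :: "'a list"
    using that by (induction l rule: vwalk_arcs.induct) auto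
  let ?l = "b # p @ [b]"
  have p: "p \<noteq> []" using assms(1) by (auto simp: vwalk_def)
  have "set (vwalk_arcs ?l) \<subseteq> parcs T"
    using assms p by (auto simp: vwalk_arcs_append vwalk_def)
  then show ?thesis
    unfolding pre_digraph.cycle_def pre_digraph.awalk_def cas_with_proj_eq awalk_verts_with_proj_eq
    using verts[of ?l] cas[of ?l] assms p by (intro exI[of _ b]) auto
qed

lemma rtrancl_crosses:
  assumes "(a, b) \<in> R\<^sup>*" "a \<in> S" "b \<notin> S"
  obtains c d where "(c, d) \<in> R" "c \<in> S" "d \<notin> S"
  using assms by (induction rule: rtrancl_induct) blast+

text \<open>Grow the rooted subtree one vertex at a time.  A second arc from a new vertex back into the
  connected set already covered would close a cycle.\<close>

lemma is_tree_rooted: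
  assumes T: "is_tree T" and r: "r \<in> pverts T"
  shows "\<exists>par h. rooted_tree (pverts T) (parcs T) r par h"
proof -
  let ?V = "pverts T" and ?E = "parcs T"
  interpret pair_graph T using T by (simp add: is_tree_def)
  have conn: "(a, b) \<in> ?E\<^sup>*" if "a \<in> ?V" "b \<in> ?V" for a b
  proof -
    have "strongly_connected (with_proj T)"
      using T sym_arcs by (intro symmetric_connected_imp_strongly_connected) (auto simp: is_tree_def)
    then have "a \<rightarrow>\<^sup>*\<^bsub>with_proj T\<^esub> b" using that by auto
    then show ?thesis by (auto dest: reachable_rtranclI)
  qed
  \<comment> \<open>The path clause asks for paths inside \<open>S\<close>: they avoid the next
    vertex \<open>b\<close>, so two arcs between \<open>b\<close> and \<open>S\<close> would close
    such a path to a cycle.\<close>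
  define P where "P S \<longleftrightarrow> S \<subseteq> ?V \<and> r \<in> S \<and> (\<exists>par h. rooted_tree S (?E \<inter> S \<times> S) r par h) \<and>
    (\<forall>a\<in>S. \<forall>b\<in>S. \<exists>p. vpath p (with_proj T) \<and> set p \<subseteq> S \<and> hd p = a \<and> last p = b)" for S
  have P0: "P {r}"
  proof -
    have "?E \<inter> {r} \<times> {r} = {}" using pair_no_loops by fastforce
    moreover have "vpath [r] (with_proj T)" using r by (auto simp: vpath_def vwalk_def)
    ultimately show ?thesis using r unfolding P_def rooted_tree_def
      by (auto intro!: exI[of _ "[r]"])
  qed
  have step: "\<exists>b\<in>?V - S. P (insert b S)" if PS: "P S" "S \<noteq> ?V" for S
  proof -
    from PS obtain par h where S: "S \<subseteq> ?V" "r \<in> S" and rt: "rooted_tree S (?E \<inter> S \<times> S) r par h"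
      and paths: "\<And>a b. a \<in> S \<Longrightarrow> b \<in> S \<Longrightarrow>
        \<exists>p. vpath p (with_proj T) \<and> set p \<subseteq> S \<and> hd p = a \<and> last p = b"
      unfolding P_def by auto
    obtain c where "c \<in> ?V" "c \<notin> S" using S(1) PS(2) by blast
    then obtain a b where ab: "(a, b) \<in> ?E" "a \<in> S" "b \<notin> S"
      using rtrancl_crosses[OF conn[OF r, of c] S(2)] by blast
    have b: "b \<in> ?V" using ab(1) by (rule in_arcsD2)
    have uniq: "a' = a" if a': "(a', b) \<in> ?E" "a' \<in> S" for a'
    proof (rule ccontr)
      assume "a' \<noteq> a"
      from paths[OF ab(2) a'(2)] obtain p where
        p: "vpath p (with_proj T)" "set p \<subseteq> S" "hd p = a" "last p = a'" by blast
      then have "pre_digraph.cycle (with_proj T) (vwalk_arcs (b # p @ [b]))"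
        using ab a' b arcs_symmetric by (intro cycle_vwalk_arcs) (auto simp: vpath_def)
      \<comment> \<open>The ends \<open>a\<close> and \<open>a'\<close> of \<open>p\<close> differ,
        so \<open>p\<close> has at least two vertices.\<close>
      moreover have "3 \<le> length (vwalk_arcs (b # p @ [b]))"
      proof -
        have "p \<noteq> []" using p by (auto simp: vpath_def vwalk_def)
        moreover have "length p \<noteq> 1" using p \<open>a' \<noteq> a\<close> by (auto simp: length_Suc_conv)
        moreover have "length (vwalk_arcs (b # p @ [b])) = length p + 1"
          using vwalk_length_simp[of "b # p @ [b]"] unfolding vwalk_length_def by simp
        ultimately show ?thesis by (cases p; cases "tl p") auto
      qed
      ultimately show False using T by (auto simp: is_tree_def)
    qed
    \<comment> \<open>The new vertex becomes a leaf below \<open>a\<close>, so the old parents and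
      values stay valid.\<close>
    have rt': "rooted_tree (insert b S) (?E \<inter> insert b S \<times> insert b S) r (par(b := a)) (h(b := Suc (h a)))"
    proof -
      have sub: "\<And>v. v \<in> S - {r} \<Longrightarrow> par v \<in> S \<and> h (par v) < h v"
        and E: "?E \<inter> S \<times> S = (\<lambda>v. (v, par v)) ` (S - {r}) \<union> (\<lambda>v. (par v, v)) ` (S - {r})"
        using rt by (auto simp: rooted_tree_def)
      have "?E \<inter> insert b S \<times> insert b S = ?E \<inter> S \<times> S \<union> {(b, a), (a, b)}"
        using ab uniq arcs_symmetric no_loops' by blast
      moreover have "insert b S - {r} = insert b (S - {r})" using S ab by auto
      moreover have "v \<noteq> b" if "v \<in> S - {r}" for v using that ab by auto
      ultimately show ?thesis
        using rt ab sub unfolding rooted_tree_def E by (auto simp: image_iff)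
    qed
    have "\<exists>p. vpath p (with_proj T) \<and> set p \<subseteq> insert b S \<and> hd p = c \<and> last p = d"
      if cd: "c \<in> insert b S" "d \<in> insert b S" for c d
    proof (cases "c = b"; cases "d = b")
      assume "c = b" "d = b"
      then show ?thesis using b by (intro exI[of _ "[b]"]) (auto simp: vpath_def vwalk_def)
    next
      assume "c = b" "d \<noteq> b"
      with paths[OF ab(2)] cd obtain p where
        p: "vpath p (with_proj T)" "set p \<subseteq> S" "hd p = a" "last p = d" by blast
      then have "vpath (b # p) (with_proj T)"
        using ab b arcs_symmetric by (auto simp: vpath_def intro: vwalk_consI)
      then show ?thesis using p \<open>c = b\<close> by (intro exI[of _ "b # p"]) (auto simp: vpath_def vwalk_def)
    next
      assume "c \<noteq> b" "d = b"
      with paths[OF _ ab(2)] cd obtain p where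
        p: "vpath p (with_proj T)" "set p \<subseteq> S" "hd p = c" "last p = a" by blast
      then have "vpath (p @ [b]) (with_proj T)"
        using ab b by (auto simp: vpath_def vwalk_def vwalk_arcs_append)
      then show ?thesis using p \<open>d = b\<close> by (intro exI[of _ "p @ [b]"]) (auto simp: vpath_def vwalk_def)
    next
      assume "c \<noteq> b" "d \<noteq> b"
      then show ?thesis using paths[of c d] cd by blast
    qed
    then have "P (insert b S)" unfolding P_def using S b rt' by blast
    then show ?thesis using ab b by blast
  qed
  have "P S \<Longrightarrow> P ?V" for S
  proof (induction "card (?V - S)" arbitrary: S rule: less_induct)
    case less
    show ?case
    proof (cases "S = ?V")
      case False
      then obtain b where b: "b \<in> ?V - S" "P (insert b S)" using step less.prems by blast
      have "card (?V - insert b S) < card (?V - S)"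
        using b pair_finite_verts by (intro psubset_card_mono) auto
      then show ?thesis using less.hyps b by blast
    qed (use less in simp)
  qed
  then have "P ?V" using P0 by blast
  moreover have "?E \<inter> ?V \<times> ?V = ?E" using in_arcsD1 in_arcsD2 by fast
  ultimately show ?thesis unfolding P_def by auto
qed

text \<open>The path starts at the root, and injectivity prevents a step back to the parent, so
  every arc leads to a child. This identifies the path neighbour of \<open>w\<close> with its
  parent.\<close>

lemma rooted_tree_path_parent:
  assumes T: "rooted_tree V E (P 0) par h" and inj: "inj_on P {..k}"
    and arc: "\<And>i. i < k \<Longrightarrow> (P i, P (Suc i)) \<in> E" and "i < k"
  shows "par (P (Suc i)) = P i"
  using \<open>i < k\<close>
proof (induction i)
  case 0
  then show ?case using arc[of 0] T by (auto simp: rooted_tree_def)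
next
  case (Suc i)
  have "P i \<noteq> P (Suc (Suc i))" using inj Suc.prems by (auto dest: inj_onD)
  then show ?case using arc[of "Suc i"] T Suc by (auto simp: rooted_tree_def)
qed

section \<open>Reversing the path of a shift\<close>

text \<open>The hypotheses are invariant under reversing the path, so every fact proved here is
  available in both directions. \<open>interior\<close> encodes degree 2, and \<open>chord\<close>
  is what remains of acyclicity.\<close>

locale bare_path =
  fixes T :: "'a pair_pre_digraph" and P :: "nat \<Rightarrow> 'a" and k :: nat
  assumes sym: "(a, b) \<in> parcs T \<Longrightarrow> (b, a) \<in> parcs T"
    and irrefl: "(a, a) \<notin> parcs T"
    and inj: "inj_on P {..k}" and k: "0 < k"
    and arc: "i < k \<Longrightarrow> (P i, P (Suc i)) \<in> parcs T"
    and interior: "\<lbrakk>0 < i; i < k; (P i, b) \<in> parcs T\<rbrakk> \<Longrightarrow> b = P (i - 1) \<or> b = P (Suc i)"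
    and chord: "(P 0, P k) \<in> parcs T \<Longrightarrow> k = 1"
begin

lemma P_eq_iff: "\<lbrakk>i \<le> k; j \<le> k\<rbrakk> \<Longrightarrow> P i = P j \<longleftrightarrow> i = j"
  using inj by (auto dest: inj_onD)

lemma reverse: "bare_path T (\<lambda>i. P (k - i)) k"
proof
  show "inj_on (\<lambda>i. P (k - i)) {..k}" by (auto simp: inj_on_def P_eq_iff)
  show "(P (k - i), P (k - Suc i)) \<in> parcs T" if "i < k" for i
    using sym[OF arc[of "k - Suc i"]] that by (simp add: Suc_diff_Suc)
  show "b = P (k - (i - 1)) \<or> b = P (k - Suc i)"
    if "0 < i" "i < k" "(P (k - i), b) \<in> parcs T" for i b
    using interior[of "k - i" b] that by (auto simp: Suc_diff_le)
  show "k = 1" if "(P (k - 0), P (k - k)) \<in> parcs T" using chord sym that by simp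
qed (use sym irrefl k in auto)

text \<open>The path is induced: \<open>interior\<close> handles arcs with an interior endpoint, and
  \<open>chord\<close> those between the two ends.\<close>

lemma path_arc_iff:
  assumes "i \<le> k" "j \<le> k"
  shows "(P i, P j) \<in> parcs T \<longleftrightarrow> j = Suc i \<or> i = Suc j"
proof
  assume "j = Suc i \<or> i = Suc j"
  then show "(P i, P j) \<in> parcs T" using arc sym assms by auto
next
  have interior': "j = Suc i \<or> i = Suc j"
    if "(P i, P j) \<in> parcs T" "i \<le> k" "j \<le> k" "0 < i" "i < k" for i j
    using interior[OF that(4,5,1)] P_eq_iff[of j "i - 1"] P_eq_iff[of j "Suc i"] that by auto
  assume a: "(P i, P j) \<in> parcs T"
  consider "0 < i" "i < k" | "0 < j" "j < k" | "i = j" | "i = 0" "j = k" | "i = k" "j = 0"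
    using assms by linarith
  then show "j = Suc i \<or> i = Suc j"
  proof cases
    case 1 then show ?thesis using interior' a assms by blast
  next
    case 2 then show ?thesis using interior'[of j i] sym[OF a] assms by blast
  next
    case 3 then show ?thesis using a irrefl by simp
  next
    case 4 then show ?thesis using a chord by simp
  next
    case 5 then show ?thesis using sym[OF a] chord by simp
  qed
qed

lemma off_path_arc:
  assumes "i \<le> k" "b \<notin> P ` {..k}" "(P i, b) \<in> parcs T"
  shows "i = 0 \<or> i = k"
  using interior[of i b] assms by (cases "0 < i \<and> i < k") auto

abbreviation "shifted \<equiv> parcs (tree_shift T (P 0) (P k) (P (k - 1)))"

text \<open>Since the path is induced, the neighbours of \<open>P k\<close> other than
  \<open>P (k - 1)\<close> are those off the path. Membership in the path does not depend on its
  direction.\<close>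

lemma shifted_iff:
  "(a, b) \<in> shifted \<longleftrightarrow>
     (let Z = {z. (P k, z) \<in> parcs T \<and> z \<notin> P ` {..k}} in
      (a, b) \<in> parcs T \<and> \<not> (a = P k \<and> b \<in> Z) \<and> \<not> (b = P k \<and> a \<in> Z) \<or>
      a = P 0 \<and> b \<in> Z \<or> b = P 0 \<and> a \<in> Z)"
proof -
  have "z \<noteq> P (k - 1) \<longleftrightarrow> z \<notin> P ` {..k}" if "(P k, z) \<in> parcs T" for z
    using path_arc_iff[of k] that by force
  then have "{z. (P k, z) \<in> parcs T \<and> z \<noteq> P (k - 1)} = {z. (P k, z) \<in> parcs T \<and> z \<notin> P ` {..k}}"
    by blast
  then show ?thesis unfolding parcs_tree_shift Let_def by auto
qed

lemma shifted_on_path: "\<lbrakk>a \<in> P ` {..k}; b \<in> P ` {..k}\<rbrakk> \<Longrightarrow> (a, b) \<in> shifted \<longleftrightarrow> (a, b) \<in> parcs T"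
  unfolding shifted_iff by (simp add: Let_def)

lemma shifted_off_path: "\<lbrakk>a \<notin> P ` {..k}; b \<notin> P ` {..k}\<rbrakk> \<Longrightarrow> (a, b) \<in> shifted \<longleftrightarrow> (a, b) \<in> parcs T"
  unfolding shifted_iff by (auto simp: Let_def)

text \<open>After the shift all outside edges of both ends hang on \<open>P 0\<close>. The outside
  neighbours are described symmetrically in the two ends, which is why the direction matters only up
  to relabelling.\<close>

lemma shifted_mixed:
  assumes "i \<le> k" "b \<notin> P ` {..k}"
  shows "(P i, b) \<in> shifted \<longleftrightarrow> i = 0 \<and> ((P 0, b) \<in> parcs T \<or> (P k, b) \<in> parcs T)"
    and "(b, P i) \<in> shifted \<longleftrightarrow> i = 0 \<and> ((P 0, b) \<in> parcs T \<or> (P k, b) \<in> parcs T)"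
proof -
  have P: "P i \<in> P ` {..k}" "P 0 \<in> P ` {..k}" "P k \<in> P ` {..k}" using assms by auto
  have eq: "P i = P 0 \<longleftrightarrow> i = 0" "P i = P k \<longleftrightarrow> i = k" using assms P_eq_iff by auto
  have comm: "(b, P i) \<in> parcs T \<longleftrightarrow> (P i, b) \<in> parcs T" using sym by blast
  show "(P i, b) \<in> shifted \<longleftrightarrow> i = 0 \<and> ((P 0, b) \<in> parcs T \<or> (P k, b) \<in> parcs T)"
    unfolding shifted_iff Let_def using P eq assms off_path_arc[of i b] k by auto
  show "(b, P i) \<in> shifted \<longleftrightarrow> i = 0 \<and> ((P 0, b) \<in> parcs T \<or> (P k, b) \<in> parcs T)"
    unfolding shifted_iff Let_def comm using P eq assms off_path_arc[of i b] k by auto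
qed

text \<open>\<open>\<pi>\<close> reverses the path and fixes all other vertices. It preserves
  adjacency on the path and carries \<open>P 0\<close>, where the outside edges are collected, to
  \<open>P k\<close>.\<close>

lemma shift_reversal:
  assumes "P ` {..k} \<subseteq> V"
  shows "\<exists>\<pi>. bij_betw \<pi> V V \<and> inj \<pi> \<and> parcs (tree_shift T (P k) (P 0) (P 1)) = map_prod \<pi> \<pi> ` shifted"
proof -
  let ?S = "P ` {..k}"
  interpret rev: bare_path T "\<lambda>i. P (k - i)" k by (rule reverse)
  have S: "(\<lambda>i. P (k - i)) ` {..k} = ?S"
  proof -
    have "P i \<in> (\<lambda>i. P (k - i)) ` {..k}" if "i \<le> k" for i
      using that by (intro image_eqI[of _ _ "k - i"]) auto
    then show ?thesis by auto
  qed
  define \<pi> where "\<pi> v = (if v \<in> ?S then P (k - inv_into {..k} P v) else v)" for v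
  have \<pi>: "\<pi> (P i) = P (k - i)" if "i \<le> k" for i
    using that inj by (auto simp: \<pi>_def)
  have \<pi>_off: "\<pi> v = v" if "v \<notin> ?S" for v using that by (simp add: \<pi>_def)
  \<comment> \<open>Being an involution makes \<open>\<pi>\<close> bijective and turns the
    equivalence \<open>iff\<close> into an equality of arc sets.\<close>
  have inv: "\<pi> (\<pi> v) = v" for v
    by (cases "v \<in> ?S") (auto simp: \<pi> \<pi>_off)
  have \<pi>_mem: "\<pi> v \<in> ?S" if "v \<in> ?S" for v
    using that \<pi> by auto
  let ?A = "parcs (tree_shift T (P k) (P 0) (P 1))"
  have A: "?A = rev.shifted" using k by simp
  have iff: "(\<pi> a, \<pi> b) \<in> ?A \<longleftrightarrow> (a, b) \<in> shifted" for a b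
  proof (cases "a \<in> ?S"; cases "b \<in> ?S")
    assume ab: "a \<in> ?S" "b \<in> ?S"
    then obtain i j where ij: "a = P i" "b = P j" "i \<le> k" "j \<le> k" by auto
    have "k - j = Suc (k - i) \<or> k - i = Suc (k - j) \<longleftrightarrow> j = Suc i \<or> i = Suc j"
      using ij by linarith
    then show ?thesis
      unfolding A rev.shifted_on_path[unfolded S, OF \<pi>_mem[OF ab(1)] \<pi>_mem[OF ab(2)]]
        shifted_on_path[OF ab]
      using ij path_arc_iff by (simp add: \<pi>)
  next
    assume ab: "a \<in> ?S" "b \<notin> ?S"
    then obtain i where i: "a = P i" "i \<le> k" by auto
    then show ?thesis
      unfolding A using rev.shifted_mixed(1)[unfolded S, of i b] shifted_mixed(1)[of "k - i" b]
        shifted_mixed(1)[of i b] rev.shifted_mixed(1)[unfolded S, of "k - (k - i)" b] ab(2)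
      by (auto simp: \<pi> \<pi>_off)
  next
    assume ab: "a \<notin> ?S" "b \<in> ?S"
    then obtain i where i: "b = P i" "i \<le> k" by auto
    then show ?thesis
      unfolding A using rev.shifted_mixed(2)[unfolded S, of i a] shifted_mixed(2)[of i a] ab(1)
      by (auto simp: \<pi> \<pi>_off)
  next
    assume ab: "a \<notin> ?S" "b \<notin> ?S"
    then show ?thesis
      unfolding A \<pi>_off[OF ab(1)] \<pi>_off[OF ab(2)]
        rev.shifted_off_path[unfolded S, OF ab] shifted_off_path[OF ab] by simp
  qed
  have "?A = map_prod \<pi> \<pi> ` shifted"
  proof (intro equalityI subsetI)
    fix e assume "e \<in> ?A"
    moreover obtain a b where "e = (a, b)" by (cases e)
    ultimately show "e \<in> map_prod \<pi> \<pi> ` shifted"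
      using iff[of "\<pi> a" "\<pi> b"] inv by (intro image_eqI[of _ _ "(\<pi> a, \<pi> b)"]) auto
  qed (use iff in auto)
  moreover have "bij_betw \<pi> V V"
  proof (rule bij_betw_byWitness[of _ \<pi>])
    have "\<pi> v \<in> V" if "v \<in> V" for v
      using that \<pi>_mem[of v] \<pi>_off[of v] assms by (cases "v \<in> ?S") auto
    then show "\<pi> ` V \<subseteq> V" "\<pi> ` V \<subseteq> V" by blast+
  qed (use inv in auto)
  moreover have "inj \<pi>" using inv by (metis injI)
  ultimately show ?thesis by blast
qed

end

section \<open>Monotonicity along the poset\<close>

lemma nth_vwalk_arcs:
  "Suc i < length p \<Longrightarrow> (p ! i, p ! Suc i) \<in> set (vwalk_arcs p)"
  by (induction p arbitrary: i rule: vwalk_arcs.induct) (auto simp: nth_Cons split: nat.splits)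

text \<open>The shift is performed onto the end of larger value. Since \<open>x\<close> is
  nonnegative, pointwise growth gives growth of the sum of squares.\<close>

lemma gts_step_tree_form:
  assumes T: "is_tree T" and step: "gts_step T T'" and x: "\<And>v. 0 \<le> x v" and q: "0 \<le> q"
  shows "\<exists>y. (\<Sum>v\<in>pverts T. (x v)\<^sup>2) \<le> (\<Sum>v\<in>pverts T. (y v)\<^sup>2) \<and>
    tree_form (pverts T) (parcs T') q y = tree_form (pverts T) (parcs T) q x"
proof -
  interpret pair_graph T using T by (simp add: is_tree_def)
  from step obtain u w p where uw: "u \<noteq> w" and p: "vpath p (with_proj T)" "hd p = u" "last p = w"
    and deg: "\<forall>v\<in>set p - {u, w}. deg T v = 2" and T': "T' = tree_shift T u w (last (butlast p))"
    unfolding gts_step_def by blast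
  define k where "k = length p - 1"
  define P where "P = (!) p"
  have ne: "p \<noteq> []" and dist: "distinct p" and sub: "set p \<subseteq> pverts T" and arcs: "set (vwalk_arcs p) \<subseteq> parcs T"
    using p by (auto simp: vpath_def vwalk_def)
  have k: "0 < k" unfolding k_def using p(2,3) uw ne by (cases p) auto
  have len: "length p = Suc k" using k k_def by simp
  have P0: "P 0 = u" and Pk: "P k = w" using p ne by (auto simp: P_def k_def hd_conv_nth last_conv_nth)
  have Pk1: "last (butlast p) = P (k - 1)"
  proof -
    have "butlast p \<noteq> []" using len k by (metis length_butlast diff_Suc_1 length_0_conv less_irrefl)
    then show ?thesis using len k by (simp add: last_conv_nth P_def nth_butlast)
  qed
  have inj: "inj_on P {..k}" using dist len by (auto simp: inj_on_def P_def nth_eq_iff_index_eq)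
  have PV: "P ` {..k} \<subseteq> pverts T" using sub len by (auto simp: P_def)
  have arc: "(P i, P (Suc i)) \<in> parcs T" if "i < k" for i
    using nth_vwalk_arcs[of i p] arcs len that by (auto simp: P_def)
  obtain par h where rt: "rooted_tree (pverts T) (parcs T) (P 0) par h"
    using is_tree_rooted[OF T, of "P 0"] PV by auto
  interpret bare_path T P k
  proof
    fix i b assume i: "0 < i" "i < k" "(P i, b) \<in> parcs T"
    have "P i \<in> set p - {u, w}"
      using i inj len unfolding P0[symmetric] Pk[symmetric]
      by (auto simp: P_def nth_eq_iff_index_eq[OF dist])
    then have card: "card (out_arcs (with_proj T) (P i)) = 2" using deg by (simp add: out_degree_def)
    \<comment> \<open>The two path arcs at \<open>P i\<close> are distinct, so with out-degree 2
      they are all the arcs leaving it.\<close>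
    have "{(P i, P (i - 1)), (P i, P (Suc i))} \<subseteq> out_arcs (with_proj T) (P i)"
      using arc[of i] arcs_symmetric[OF arc[of "i - 1"]] i by auto
    moreover have "P (i - 1) \<noteq> P (Suc i)" using inj i by (auto dest: inj_onD)
    ultimately have "{(P i, P (i - 1)), (P i, P (Suc i))} = out_arcs (with_proj T) (P i)"
      using card by (intro card_subset_eq) auto
    moreover have "(P i, b) \<in> out_arcs (with_proj T) (P i)" using i by simp
    ultimately show "b = P (i - 1) \<or> b = P (Suc i)" by blast
  next
    assume "(P 0, P k) \<in> parcs T"
    moreover have "P k \<noteq> P 0" using P0 Pk uw by simp
    \<comment> \<open>The root \<open>P 0\<close> has no parent, so it is the parent of any
      neighbour; but the parent of \<open>P k\<close> is also its predecessor on the path.\<close>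
    ultimately have "par (P k) = P 0" using rt by (auto simp: rooted_tree_def)
    moreover have "par (P k) = P (k - 1)"
      using rooted_tree_path_parent[OF rt inj arc, of "k - 1"] k by simp
    ultimately show "k = 1" using inj k by (auto dest: inj_onD)
  qed (use arcs_symmetric no_loops' inj k arc in auto)
  \<comment> \<open>Stated for any \<open>Q\<close>, to serve both \<open>P\<close> and its
    reversal.\<close>
  have up: "\<exists>y. (\<forall>v\<in>pverts T. x v \<le> y v) \<and>
      tree_form (pverts T) (parcs (tree_shift T (Q 0) (Q k) (Q (k - 1)))) q y = tree_form (pverts T) (parcs T) q x"
    if Q: "bare_path T Q k" "Q ` {..k} \<subseteq> pverts T" and le: "x (Q k) \<le> x (Q 0)" for Q
  proof -
    interpret Q: bare_path T Q k by (rule Q)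
    obtain par h where rt: "rooted_tree (pverts T) (parcs T) (Q 0) par h"
      using is_tree_rooted[OF T, of "Q 0"] Q(2) by auto
    have "par (Q k) = Q (k - 1)"
      using rooted_tree_path_parent[OF rt Q.inj Q.arc, of "k - 1"] k by simp
    moreover have "Q k \<noteq> Q 0" using Q.P_eq_iff k by simp
    ultimately show ?thesis using tree_form_shift_le[OF rt, of "Q k" x q] Q(2) x q le by auto
  qed
  have sq: "(\<Sum>v\<in>pverts T. (x v)\<^sup>2) \<le> (\<Sum>v\<in>pverts T. (y v)\<^sup>2)" if "\<forall>v\<in>pverts T. x v \<le> y v" for y
    using that x by (intro sum_mono power_mono) auto
  show ?thesis
  proof (cases "x w \<le> x u")
    case True
    then show ?thesis using up[of P] PV sq P0 Pk Pk1 T' bare_path_axioms by auto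
  next
    case False
    \<comment> \<open>Now \<open>w\<close> has the larger value: shift onto \<open>w\<close>
      instead, and pull \<open>y\<close> back along \<open>\<pi>\<close>, which preserves the sum of
      squares.\<close>
    have "(\<lambda>i. P (k - i)) ` {..k} \<subseteq> pverts T" using PV by auto
    from up[OF reverse this] False k obtain y where le: "\<forall>v\<in>pverts T. x v \<le> y v"
      and y: "tree_form (pverts T) (parcs (tree_shift T (P k) (P 0) (P 1))) q y = tree_form (pverts T) (parcs T) q x"
      by (auto simp: P0 Pk)
    from shift_reversal[OF PV] obtain \<pi> where \<pi>: "bij_betw \<pi> (pverts T) (pverts T)" "inj \<pi>"
      "parcs (tree_shift T (P k) (P 0) (P 1)) = map_prod \<pi> \<pi> ` shifted" by blast
    have "inj_on (map_prod \<pi> \<pi>) shifted" using \<pi>(2) by (intro inj_on_subset[OF prod.inj_map]) auto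
    from tree_form_image[OF \<pi>(1) this \<pi>(3)] y
    have "tree_form (pverts T) (parcs T') q (y \<circ> \<pi>) = tree_form (pverts T) (parcs T) q x"
      by (simp add: T' P0 Pk Pk1)
    moreover have "(\<Sum>v\<in>pverts T. ((y \<circ> \<pi>) v)\<^sup>2) = (\<Sum>v\<in>pverts T. (y v)\<^sup>2)"
      using sum.reindex_bij_betw[OF \<pi>(1), of "\<lambda>v. (y v)\<^sup>2"] by simp
    ultimately show ?thesis using sq[OF le] by metis
  qed
qed

section \<open>From forms to the smallest eigenvalue of the q-Laplacian\<close>

lemma n_trees_arcs_subset: "T \<in> n_trees n \<Longrightarrow> parcs T \<subseteq> {0..<n} \<times> {0..<n}"
proof -
  assume T: "T \<in> n_trees n"
  then interpret pair_graph T by (simp add: n_trees_def is_tree_def)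
  show ?thesis using T in_arcsD1 in_arcsD2 by (auto simp: n_trees_def)
qed

lemma n_trees_pos: "T \<in> n_trees n \<Longrightarrow> 0 < n"
  by (cases n) (auto simp: n_trees_def is_tree_def connected_conv)

lemma q_laplacian_carrier: "q_laplacian n q T \<in> carrier_mat n n"
  by (auto simp: q_laplacian_def deg_matrix_def adj_matrix_def)

lemma q_laplacian_symmetric:
  assumes "T \<in> n_trees n"
  shows "transpose_mat (q_laplacian n q T) = q_laplacian n q T"
proof -
  interpret pair_graph T using assms by (simp add: n_trees_def is_tree_def)
  have "(i, j) \<in> parcs T \<longleftrightarrow> (j, i) \<in> parcs T" for i j using arcs_symmetric by blast
  then show ?thesis
    by (intro eq_matI) (auto simp: q_laplacian_def deg_matrix_def adj_matrix_def)
qed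

text \<open>A diagonal entry splits into \<open>1 - q\<^sup>2\<close> and one
  \<open>q\<^sup>2\<close> for each arc leaving the vertex, so each row becomes a sum over
  arcs.\<close>

lemma q_laplacian_tree_form:
  assumes T: "T \<in> n_trees n"
  shows "vec n x \<bullet> (q_laplacian n q T *\<^sub>v vec n x) = tree_form {0..<n} (parcs T) q x"
proof -
  let ?E = "parcs T"
  note E = n_trees_arcs_subset[OF T]
  have arcs: "(\<Sum>(a, b)\<in>?E. f a b) = (\<Sum>i\<in>{0..<n}. \<Sum>j\<in>{0..<n}. if (i, j) \<in> ?E then f i j else 0)"
    for f :: "nat \<Rightarrow> nat \<Rightarrow> real"
    using E unfolding sum.cartesian_product
    by (intro sum.mono_neutral_cong_left) auto
  have deg: "real (deg T i) = (\<Sum>j\<in>{0..<n}. if (i, j) \<in> ?E then 1 else 0)" for i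
  proof -
    have "out_arcs (with_proj T) i = Pair i ` {j \<in> {0..<n}. (i, j) \<in> ?E}"
      using E by (auto simp: out_arcs_def)
    then have "deg T i = card {j \<in> {0..<n}. (i, j) \<in> ?E}"
      by (simp add: out_degree_def card_image inj_on_def)
    then show ?thesis by (simp add: sum.If_cases Int_def)
  qed
  have row: "(\<Sum>j\<in>{0..<n}. x i * q_laplacian n q T $$ (i, j) * x j) = (1 - q\<^sup>2) * (x i)\<^sup>2 +
      (\<Sum>j\<in>{0..<n}. if (i, j) \<in> ?E then q\<^sup>2 * (x i)\<^sup>2 - q * x i * x j else 0)" if i: "i < n" for i
  proof -
    have "(\<Sum>j\<in>{0..<n}. x i * q_laplacian n q T $$ (i, j) * x j) =
      (\<Sum>j\<in>{0..<n}. (if i = j then (1 - q\<^sup>2) * (x i)\<^sup>2 + real (deg T i) * (q\<^sup>2 * (x i)\<^sup>2) else 0)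
        - (if (i, j) \<in> ?E then q * x i * x j else 0))"
      using i by (intro sum.cong)
        (auto simp: q_laplacian_def deg_matrix_def adj_matrix_def power2_eq_square algebra_simps)
    also have "\<dots> = (1 - q\<^sup>2) * (x i)\<^sup>2 + real (deg T i) * (q\<^sup>2 * (x i)\<^sup>2)
        - (\<Sum>j\<in>{0..<n}. if (i, j) \<in> ?E then q * x i * x j else 0)"
      using i by (simp add: sum_subtractf)
    also have "real (deg T i) * (q\<^sup>2 * (x i)\<^sup>2) = (\<Sum>j\<in>{0..<n}. if (i, j) \<in> ?E then q\<^sup>2 * (x i)\<^sup>2 else 0)"
      unfolding deg sum_distrib_right by (rule sum.cong) auto
    also have "(1 - q\<^sup>2) * (x i)\<^sup>2 + (\<Sum>j\<in>{0..<n}. if (i, j) \<in> ?E then q\<^sup>2 * (x i)\<^sup>2 else 0)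
        - (\<Sum>j\<in>{0..<n}. if (i, j) \<in> ?E then q * x i * x j else 0) = (1 - q\<^sup>2) * (x i)\<^sup>2 +
        (\<Sum>j\<in>{0..<n}. if (i, j) \<in> ?E then q\<^sup>2 * (x i)\<^sup>2 - q * x i * x j else 0)"
      unfolding add_diff_eq[symmetric] sum_subtractf[symmetric]
      by (intro arg_cong2[where f = "(+)"] sum.cong) auto
    finally show ?thesis .
  qed
  have "vec n x \<bullet> (q_laplacian n q T *\<^sub>v vec n x) =
      (\<Sum>i\<in>{0..<n}. \<Sum>j\<in>{0..<n}. x i * q_laplacian n q T $$ (i, j) * x j)"
    unfolding scalar_prod_mat_eq_sum[OF q_laplacian_carrier vec_carrier]
    by (simp add: atLeast0LessThan)
  also have "\<dots> = tree_form {0..<n} ?E q x"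
    unfolding tree_form_def arcs by (simp add: row sum.distrib)
  finally show ?thesis .
qed

text \<open>A minimizing eigenvector of \<open>T\<close> is made nonnegative, passed to
  \<open>T'\<close> by \<open>forms\<close>, and given signs to return from
  \<open>\<bar>q\<bar>\<close> to \<open>q\<close>. The result is a test vector for
  \<open>T'\<close>.\<close>

lemma lambda_min_le_if_forms:
  assumes T: "T \<in> n_trees n" "T' \<in> n_trees n" and q: "\<bar>q\<bar> \<le> 1"
    and forms: "\<And>x. (\<And>v. 0 \<le> x v) \<Longrightarrow>
      \<exists>y. (\<Sum>v\<in>{0..<n}. (x v)\<^sup>2) \<le> (\<Sum>v\<in>{0..<n}. (y v)\<^sup>2) \<and>
        tree_form {0..<n} (parcs T') (\<bar>q\<bar>) y \<le> tree_form {0..<n} (parcs T) (\<bar>q\<bar>) x"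
  shows "lambda_min (q_laplacian n q T') \<le> lambda_min (q_laplacian n q T)"
proof -
  let ?V = "{0..<n}" and ?L = "q_laplacian n q"
  have n: "0 < n" using n_trees_pos T by blast
  have root: "\<exists>par h. rooted_tree ?V (parcs S) 0 par h" if "S \<in> n_trees n" for S
    using is_tree_rooted[of S 0] that n by (simp add: n_trees_def)
  have norm: "vec n x \<bullet> vec n x = (\<Sum>v\<in>?V. (x v)\<^sup>2)" for x :: "nat \<Rightarrow> real"
    by (simp add: scalar_prod_def power2_eq_square)
  let ?l = "lambda_min (?L T)" and ?l' = "lambda_min (?L T')"
  obtain v where v: "v \<in> carrier_vec n" "v \<noteq> 0\<^sub>v n" "?L T *\<^sub>v v = ?l \<cdot>\<^sub>v v"
    using lambda_min_Rayleigh(1)[OF q_laplacian_carrier q_laplacian_symmetric[OF T(1), of q] n]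
      q_laplacian_carrier[of n q T]
    unfolding eigenvalue_def eigenvector_def by auto
  define x where "x i = v $ i" for i
  have vx: "v = vec n x" using v(1) by (auto simp: x_def)
  have "tree_form ?V (parcs T) q x = ?l * (\<Sum>i\<in>?V. (x i)\<^sup>2)"
    unfolding q_laplacian_tree_form[OF T(1), symmetric] norm[symmetric]
    using v by (simp flip: vx)
  have pos: "0 < (\<Sum>i\<in>?V. (x i)\<^sup>2)"
    using scalar_prod_self_pos[OF v(1,2)] by (simp add: vx norm)
  obtain par h where "rooted_tree ?V (parcs T) 0 par h" using root T by blast
  then have "0 \<le> tree_form ?V (parcs T) q x" using q by (rule tree_form_nonneg)
  \<comment> \<open>The test vector may have larger norm than \<open>x\<close>; this lowers the
    Rayleigh quotient only because the eigenvalue is nonnegative, which is where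
    \<open>\<bar>q\<bar> \<le> 1\<close> enters.\<close>
  then have l: "0 \<le> ?l" using pos \<open>tree_form ?V (parcs T) q x = _\<close> by (simp add: zero_le_mult_iff)
  from forms[of "\<lambda>v. \<bar>x v\<bar>"] obtain y where
    y: "(\<Sum>v\<in>?V. (x v)\<^sup>2) \<le> (\<Sum>v\<in>?V. (y v)\<^sup>2)"
      "tree_form ?V (parcs T') (\<bar>q\<bar>) y \<le> tree_form ?V (parcs T) \<bar>q\<bar> (\<lambda>v. \<bar>x v\<bar>)" by auto
  obtain par' h' where "rooted_tree ?V (parcs T') 0 par' h'" using root T by blast
  from tree_form_abs[OF this, of y q] obtain z where
    z: "\<forall>v\<in>?V. (z v)\<^sup>2 = (y v)\<^sup>2" "tree_form ?V (parcs T') q z = tree_form ?V (parcs T') (\<bar>q\<bar>) y"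
    by blast
  have "?l' * (\<Sum>v\<in>?V. (z v)\<^sup>2) \<le> tree_form ?V (parcs T') q z"
    using lambda_min_Rayleigh(2)[OF q_laplacian_carrier q_laplacian_symmetric[OF T(2)] n, of "vec n z"]
    unfolding q_laplacian_tree_form[OF T(2)] norm by simp
  also have "\<dots> \<le> tree_form ?V (parcs T) q x"
    using z(2) y(2) tree_form_abs_le[of ?V "parcs T" q x] by linarith
  also have "\<dots> = ?l * (\<Sum>v\<in>?V. (x v)\<^sup>2)" by fact
  also have "\<dots> \<le> ?l * (\<Sum>v\<in>?V. (y v)\<^sup>2)" using y(1) l by (rule mult_left_mono)
  also have "(\<Sum>v\<in>?V. (y v)\<^sup>2) = (\<Sum>v\<in>?V. (z v)\<^sup>2)" using z(1) by simp
  finally show ?thesis using pos y(1) z(1) by simp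
qed

lemma lambda_min_gts_step:
  assumes "T \<in> n_trees n" "T' \<in> n_trees n" "gts_step T T'" "\<bar>q\<bar> \<le> 1"
  shows "lambda_min (q_laplacian n q T') \<le> lambda_min (q_laplacian n q T)"
proof (rule lambda_min_le_if_forms[OF assms(1,2,4)])
  fix x :: "nat \<Rightarrow> real" assume x: "\<And>v. 0 \<le> x v"
  have "is_tree T" and V: "pverts T = {0..<n}" using assms(1) by (auto simp: n_trees_def)
  from gts_step_tree_form[OF this(1) assms(3), of x "\<bar>q\<bar>"] x show "\<exists>y. (\<Sum>v\<in>{0..<n}. (x v)\<^sup>2) \<le> (\<Sum>v\<in>{0..<n}. (y v)\<^sup>2) \<and>
      tree_form {0..<n} (parcs T') (\<bar>q\<bar>) y \<le> tree_form {0..<n} (parcs T) (\<bar>q\<bar>) x"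
    unfolding V by (metis abs_ge_zero order_refl)
qed

section \<open>Isomorphism classes and chains of shifts\<close>

lemma lambda_min_iso_le:
  assumes T: "T \<in> n_trees n" "T' \<in> n_trees n" and iso: "digraph_iso (with_proj T) (with_proj T')"
    and q: "\<bar>q\<bar> \<le> 1"
  shows "lambda_min (q_laplacian n q T) \<le> lambda_min (q_laplacian n q T')"
proof -
  obtain f where f: "pre_digraph.digraph_isomorphism (with_proj T) f" "with_proj T' = app_iso f (with_proj T)"
    using iso unfolding digraph_iso_def by blast
  define g where "g = iso_verts f"
  have V: "pverts T = {0..<n}" "pverts T' = {0..<n}" using T by (auto simp: n_trees_def)
  have inj: "inj_on g {0..<n}" using f(1) V by (simp add: pre_digraph.digraph_isomorphism_def g_def)
  have bij: "bij_betw g {0..<n} {0..<n}"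
    using inj arg_cong[OF f(2), of verts] V by (simp add: bij_betw_def g_def)
  \<comment> \<open>An arc of a pair graph is its pair of endpoints, so compatibility with tail and
    head determines \<open>iso_arcs f\<close> from \<open>g\<close>.\<close>
  have "iso_arcs f e = map_prod g g e" if "e \<in> parcs T" for e
  proof (rule prod_eqI)
    show "fst (iso_arcs f e) = fst (map_prod g g e)"
      using f(1) arg_cong[OF f(2), of tail] that by (auto simp: pre_digraph.digraph_isomorphism_def g_def)
    show "snd (iso_arcs f e) = snd (map_prod g g e)"
      using f(1) arg_cong[OF f(2), of head] that by (auto simp: pre_digraph.digraph_isomorphism_def g_def)
  qed
  then have arcs: "parcs T' = map_prod g g ` parcs T"
    using arg_cong[OF f(2), of arcs] by simp
  have "inj_on (map_prod g g) (parcs T)"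
    using map_prod_inj_on[OF inj inj] n_trees_arcs_subset[OF T(1)] by (rule inj_on_subset)
  note image = tree_form_image[OF bij this arcs]
  show ?thesis
  proof (rule lambda_min_le_if_forms[OF T(2,1) q])
    fix x :: "nat \<Rightarrow> real"
    have "(\<Sum>v\<in>{0..<n}. ((x \<circ> g) v)\<^sup>2) = (\<Sum>v\<in>{0..<n}. (x v)\<^sup>2)"
      using sum.reindex_bij_betw[OF bij, of "\<lambda>v. (x v)\<^sup>2"] by simp
    then show "\<exists>y. (\<Sum>v\<in>{0..<n}. (x v)\<^sup>2) \<le> (\<Sum>v\<in>{0..<n}. (y v)\<^sup>2) \<and>
      tree_form {0..<n} (parcs T) (\<bar>q\<bar>) y \<le> tree_form {0..<n} (parcs T') (\<bar>q\<bar>) x"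
      using image by (intro exI[of _ "x \<circ> g"]) auto
  qed
qed

lemma lambda_min_GTS_carrier:
  assumes X: "X \<in> GTS_carrier n" and T: "T \<in> X" "T' \<in> X" and q: "\<bar>q\<bar> \<le> 1"
  shows "T \<in> n_trees n" "lambda_min (q_laplacian n q T) = lambda_min (q_laplacian n q T')"
proof -
  obtain S where "X = iso_rel n `` {S}" using X by (auto simp: GTS_carrier_def quotient_def)
  then have S: "R \<in> n_trees n \<and> S \<in> n_trees n \<and> digraph_iso (with_proj S) (with_proj R)" if "R \<in> X" for R
    using that by (auto simp: iso_rel_def)
  have "lambda_min (q_laplacian n q R) = lambda_min (q_laplacian n q S)" if "R \<in> X" for R
  proof (rule antisym)
    note R = S[OF that]
    interpret pair_graph S using R by (simp add: n_trees_def is_tree_def)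
    have "digraph_iso (with_proj R) (with_proj S)"
      using R wf_digraph by (blast intro: digraph_iso_swap)
    then show "lambda_min (q_laplacian n q R) \<le> lambda_min (q_laplacian n q S)"
      using R lambda_min_iso_le q by blast
    show "lambda_min (q_laplacian n q S) \<le> lambda_min (q_laplacian n q R)"
      using R lambda_min_iso_le q by blast
  qed
  then show "T \<in> n_trees n" "lambda_min (q_laplacian n q T) = lambda_min (q_laplacian n q T')"
    using S T by auto
qed

text \<open>Consecutive steps in a chain may use different representatives of a class; constancy of
  the eigenvalue on classes bridges them.\<close>

lemma lambda_min_GTS_le:
  assumes le: "GTS_le n X Y" and T: "T \<in> X" and q: "\<bar>q\<bar> \<le> 1" and T': "T' \<in> Y"
  shows "lambda_min (q_laplacian n q T') \<le> lambda_min (q_laplacian n q T)"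
proof -
  have X: "X \<in> GTS_carrier n" and steps: "(GTS_step n)\<^sup>*\<^sup>* X Y" using le by (auto simp: GTS_le_def)
  from steps T' show ?thesis
  proof (induction arbitrary: T' rule: rtranclp_induct)
    case base
    then show ?case using lambda_min_GTS_carrier(2)[OF X base T q] by simp
  next
    case (step Y Z)
    then obtain R R' where R: "R \<in> Y" "R' \<in> Z" "gts_step R R'" "Y \<in> GTS_carrier n" "Z \<in> GTS_carrier n"
      by (auto simp: GTS_step_def)
    have "lambda_min (q_laplacian n q T') = lambda_min (q_laplacian n q R')"
      by (rule lambda_min_GTS_carrier(2)[OF R(5) step.prems R(2) q])
    also have "\<dots> \<le> lambda_min (q_laplacian n q R)"
      by (rule lambda_min_gts_step[OF lambda_min_GTS_carrier(1)[OF R(4,1,1) q]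
            lambda_min_GTS_carrier(1)[OF R(5,2,2) q] R(3) q])
    also have "\<dots> \<le> lambda_min (q_laplacian n q T)" by (rule step.IH[OF R(1)])
    finally show ?case .
  qed
qed

lemma iso_class_self:
  assumes "T \<in> n_trees n"
  shows "T \<in> iso_class n T"
proof -
  interpret pair_graph T using assms by (simp add: n_trees_def is_tree_def)
  have "pre_digraph.digraph_isomorphism (with_proj T)
      \<lparr>iso_verts = id, iso_arcs = id, iso_head = snd, iso_tail = fst\<rparr>"
    using wf_digraph by (auto simp: digraph_isomorphism_def)
  moreover have "with_proj T =
      app_iso \<lparr>iso_verts = id, iso_arcs = id, iso_head = snd, iso_tail = fst\<rparr> (with_proj T)"
    by (simp add: app_iso_def with_proj_def)
  ultimately have "digraph_iso (with_proj T) (with_proj T)"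
    unfolding digraph_iso_def by (intro exI conjI)
  then show ?thesis using assms by (simp add: iso_class_def iso_rel_def)
qed

theorem theorem6p5:
  fixes n :: nat and T1 T2 :: "nat pair_pre_digraph"
  assumes "T1 \<in> n_trees n" and "T2 \<in> n_trees n"
    and "GTS_covers n (iso_class n T2) (iso_class n T1)"
  shows "\<forall>q::real. q \<noteq> 0 \<and> \<bar>q\<bar> \<le> 1 \<longrightarrow>
    lambda_min (q_laplacian n q T1) \<ge> lambda_min (q_laplacian n q T2)"
proof (intro allI impI)
  fix q :: real assume "q \<noteq> 0 \<and> \<bar>q\<bar> \<le> 1"
  moreover have "GTS_le n (iso_class n T1) (iso_class n T2)"
    using assms(3) by (simp add: GTS_covers_def)
  ultimately show "lambda_min (q_laplacian n q T1) \<ge> lambda_min (q_laplacian n q T2)"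
    using lambda_min_GTS_le[OF _ iso_class_self[OF assms(1)] _ iso_class_self[OF assms(2)]] by simp
qed

end
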